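(* Assume the Hardy–Littlewood/Bateman–Horn conjecture stated in the context. Then: (1) there exist infinitely many exceptional odd primes $m$, and infinitely many exceptional $m\in J$ of the form $m=pq$ with $p,q$ odd primes, $p<q<4p$; (2) there exist infinitely many ordinary $m\in J$ of the form $m=pq$ with $p,q$ odd primes, $p<q<4p$.
   Context: Conjecture (Hardy–Littlewood, Bateman–Horn): Let $f_1,\dots,f_r\in\mathbb{Z}[x]$, $f=f_1\cdots f_r$, satisfy (i) $f_1,\dots,f_r$ are distinct; (ii) each $f_i$ is irreducible in $\mathbb{Z}[x]$; (iii) each $f_i$ has positive leading coefficient; (iv) there is no prime $\ell$ with $\ell\mid f(n)$ for all $n\in\mathbb{Z}_{>0}$. Then $\#\{n\le x: f_1(n),\dots,f_r(n)\text{ all prime}\}\sim \frac{C(f_1,\dots,f_r)}{(\deg f_1)\cdots(\deg f_r)}\frac{x}{(\log x)^r}$, where $C(f_1,\dots,f_r)=\prod_p(1-\nu_f(p)/p)(1-1/p)^{-r}$ and $\nu_f(p)$ is the number of solutions of $f(n)\equiv 0\pmod p$ in $\mathbb{Z}/p\mathbb{Z}$. For odd $m\ge 3$ let $\mathbb{Z}_m=\mathbb{Z}/m\mathbb{Z}$. A Cayley subset of $\mathbb{Z}_m$ is a subset $S$ with $0\notin S$, $S=-S$, generating $\mathbb{Z}_m$. $X(S)$ is the Cayley graph on $\mathbb{Z}_m$ ($x\sim y$ iff $y-x\in S$), with non-trivial eigenvalues $\mu_j(S)=\sum_{a\in S}e^{2\pi i a j/m}$ ($1\le j\le m-1$) and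 $\mu(S)=\max_j|\mu_j(S)|$; it is Ramanujan if $\mu(S)\le 2\sqrt{|S|-1}$. The covalency is $l(S)=m-|S|$. $\hat{l}$ is the largest covalency value $l$ such that $X(S)$ is Ramanujan for every Cayley subset $S$ with $l(S)\le l$. With $l_0=2\lfloor\sqrt{m}-\frac32\rfloor+1$, an odd $m\ge 15$ is ordinary if $\hat l=l_0$ and exceptional if $\hat l=l_0+2$. $J=\{2n+1: 7\le n\le 14\}\cup\{k^2+5k+c: k\ge 4,\ c\in\{\pm1,\pm3,5\}\}\cup\{k^2+5k-5: k\ge 19\}$. *)

theory Defs
  imports
    "HOL-Analysis.Infinite_Products"
    "HOL-Library.Landau_Symbols"
    "HOL-Computational_Algebra.Polynomial_Factorial"
    "HOL-Number_Theory.Cong"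
    "HOL-Algebra.Elementary_Groups"
begin

section \<open>The Hardy--Littlewood/Bateman--Horn conjecture\<close>

definition root_count_mod :: "int poly \<Rightarrow> nat \<Rightarrow> nat" where
  "root_count_mod f p = card {a \<in> {0..<int p}. [poly f a = 0] (mod int p)}"

text \<open>
  The product over the primes converges only conditionally in general, so it is taken
  in increasing order of the primes.
\<close>

definition bateman_horn_const :: "int poly list \<Rightarrow> real" where
  "bateman_horn_const fs =
     (\<Prod>p. if prime (p::nat)
           then (1 - real (root_count_mod (prod_list fs) p) / real p)
                / (1 - 1 / real p) ^ length fs
           else 1)"

definition bateman_horn_conjecture :: bool where
  "bateman_horn_conjecture \<longleftrightarrow>
     (\<forall>fs :: int poly list.
        fs \<noteq> [] \<and> distinct fs \<and>
        (\<forall>f \<in> set fs. irreducible f) \<and>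
        (\<forall>f \<in> set fs. lead_coeff f > 0) \<and>
        \<not> (\<exists>l::nat. prime l \<and> (\<forall>n::nat. n > 0 \<longrightarrow> int l dvd poly (prod_list fs) (int n)))
        \<longrightarrow>
        (\<lambda>x::real. real (card {n::nat. n > 0 \<and> real n \<le> x \<and>
                                 (\<forall>f \<in> set fs. prime (poly f (int n)))}))
        \<sim>[at_top]
        (\<lambda>x. bateman_horn_const fs / real (\<Prod>f\<leftarrow>fs. degree f) * (x / ln x ^ length fs)))"


section \<open>Cayley graphs on the integers modulo m\<close>

definition cayley_subset :: "nat \<Rightarrow> int set \<Rightarrow> bool" where
  "cayley_subset m S \<longleftrightarrow>
     S \<subseteq> carrier (integer_mod_group m) \<and> 0 \<notin> S \<and>
     (\<lambda>a. inv\<^bsub>integer_mod_group m\<^esub> a) ` S = S \<and>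
     generate (integer_mod_group m) S = carrier (integer_mod_group m)"

definition cayley_adj :: "nat \<Rightarrow> int set \<Rightarrow> int \<Rightarrow> int \<Rightarrow> bool" where
  "cayley_adj m S x y \<longleftrightarrow>
     x \<in> carrier (integer_mod_group m) \<and> y \<in> carrier (integer_mod_group m) \<and>
     y \<otimes>\<^bsub>integer_mod_group m\<^esub> inv\<^bsub>integer_mod_group m\<^esub> x \<in> S"

definition cayley_eigenvalue :: "nat \<Rightarrow> int set \<Rightarrow> nat \<Rightarrow> complex" where
  "cayley_eigenvalue m S j =
     (\<Sum>a\<in>S. exp (2 * of_real pi * \<i> * of_int a * of_nat j / of_nat m))"

text \<open>
  The characters of the group are eigenvectors of the adjacency operator of the
  Cayley graph, with the numbers above as eigenvalues.
\<close>

lemma cayley_adj_eigenvector: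
  fixes m j :: nat and S :: "int set" and x :: int
  defines "\<psi> \<equiv> \<lambda>a::int. exp (2 * of_real pi * \<i> * of_int a * of_nat j / of_nat m) :: complex"
  assumes m: "m > 0" and S: "S \<subseteq> carrier (integer_mod_group m)"
    and x: "x \<in> carrier (integer_mod_group m)"
  shows "(\<Sum>y | cayley_adj m S x y. \<psi> y) = cayley_eigenvalue m S j * \<psi> x"
proof -
  have per: "\<psi> (a mod int m) = \<psi> a" for a
  proof -
    have "of_int a = of_int (a mod int m) + (of_nat m * of_int (a div int m) :: complex)"
      by (metis add.commute mult_div_mod_eq of_int_add of_int_mult of_int_of_nat_eq)
    hence "2 * of_real pi * \<i> * of_int a * of_nat j / of_nat m =
        2 * of_real pi * \<i> * of_int (a mod int m) * of_nat j / of_nat m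
        + \<i> * of_real (2 * pi * of_int (a div int m * int j))"
      using m by (simp add: field_simps)
    moreover have "exp (\<i> * of_real (2 * pi * of_int (a div int m * int j))) = 1"
      using cis_multiple_2pi [of "of_int (a div int m * int j)"] by (simp add: cis_conv_exp)
    ultimately show ?thesis
      unfolding \<psi>_def by (simp add: exp_add)
  qed
  have hom: "\<psi> (a + b) = \<psi> a * \<psi> b" for a b
    unfolding \<psi>_def by (simp add: exp_add [symmetric] ring_distribs add_divide_distrib)
  have "(\<Sum>y | cayley_adj m S x y. \<psi> y) = (\<Sum>a\<in>S. \<psi> ((a + x) mod int m))"
  proof (rule sum.reindex_bij_witness
      [where i = "\<lambda>a. (a + x) mod int m" and j = "\<lambda>y. (y - x) mod int m"])
    fix y assume "y \<in> {y. cayley_adj m S x y}"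
    then show "((y - x) mod int m + x) mod int m = y" "(y - x) mod int m \<in> S"
      "\<psi> (((y - x) mod int m + x) mod int m) = \<psi> y"
      using m x
      by (auto simp: cayley_adj_def carrier_integer_mod_group mod_add_left_eq mod_add_right_eq)
  next
    fix a assume a: "a \<in> S"
    then have *: "((a + x) mod int m - x) mod int m = a"
      using m S by (auto simp: mod_diff_left_eq carrier_integer_mod_group)
    then show "((a + x) mod int m - x) mod int m = a" .
    show "(a + x) mod int m \<in> {y. cayley_adj m S x y}"
      using * a m x
      by (auto simp: cayley_adj_def carrier_integer_mod_group mod_add_right_eq)
  qed
  also have "\<dots> = cayley_eigenvalue m S j * \<psi> x"
    by (simp only: per hom cayley_eigenvalue_def sum_distrib_right flip: \<psi>_def)
  finally show ?thesis .
qed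

definition cayley_mu :: "nat \<Rightarrow> int set \<Rightarrow> real" where
  "cayley_mu m S = (MAX j\<in>{1..m - 1}. cmod (cayley_eigenvalue m S j))"

definition cayley_ramanujan :: "nat \<Rightarrow> int set \<Rightarrow> bool" where
  "cayley_ramanujan m S \<longleftrightarrow> cayley_mu m S \<le> 2 * sqrt (real (card S) - 1)"

definition covalency :: "nat \<Rightarrow> int set \<Rightarrow> nat" where
  "covalency m S = m - card S"

definition l_hat :: "nat \<Rightarrow> nat" where
  "l_hat m = Max {l. (\<exists>S. cayley_subset m S \<and> covalency m S = l) \<and>
                     (\<forall>S. cayley_subset m S \<and> covalency m S \<le> l \<longrightarrow> cayley_ramanujan m S)}"

definition l_zero :: "nat \<Rightarrow> int" where
  "l_zero m = 2 * \<lfloor>sqrt (real m) - 3 / 2\<rfloor> + 1"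

definition ordinary :: "nat \<Rightarrow> bool" where
  "ordinary m \<longleftrightarrow> odd m \<and> m \<ge> 15 \<and> int (l_hat m) = l_zero m"

definition exceptional :: "nat \<Rightarrow> bool" where
  "exceptional m \<longleftrightarrow> odd m \<and> m \<ge> 15 \<and> int (l_hat m) = l_zero m + 2"

definition J_set :: "nat set" where
  "J_set = {2 * n + 1 | n. 7 \<le> n \<and> n \<le> 14} \<union>
     {m. \<exists>k::nat. k \<ge> 4 \<and> (\<exists>c\<in>{1, -1, 3, -3, 5}. int m = int k ^ 2 + 5 * int k + c)} \<union>
     {m. \<exists>k::nat. k \<ge> 19 \<and> int m = int k ^ 2 + 5 * int k - 5}"

end

theory Submission
  imports Defs
begin

text \<open>
  Let \<open>f(k) = k\<^sup>2 + 5k + 5\<close> and \<open>m = f(k)\<close>, so that \<open>l\<^sub>0 = 2k + 1\<close>. Writing \<open>T\<close> for the complement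
  of \<open>S\<close> and \<open>l = |T|\<close>, the eigenvalues are \<open>-\<Sum>\<^bsub>a\<in>T\<^esub> cos(2\<pi>aj/m)\<close>, and for \<open>l = l\<^sub>0 + 2\<close> the Ramanujan
  bound is \<open>sqrt(l\<^sup>2 - 5)\<close>, only about \<open>5/(2l)\<close> below the trivial bound \<open>l\<close>.

  If every \<open>gcd(j, m)\<close> is 1 or comparable to \<open>sqrt m\<close>, then multiplication by \<open>j\<close> cannot keep most of
  \<open>T\<close> near 0 and the cosine sum is at most \<open>l - 3/l\<close>, so \<open>m\<close> is exceptional. This covers \<open>m\<close> prime and
  \<open>m = f(x) f(x+1) = f(x + f(x))\<close> with both factors prime. If instead \<open>m = pq\<close> with \<open>p = n\<^sup>2 + n - 1\<close> and
  \<open>q = 4n\<^sup>2 - 5\<close>, where again \<open>m = f(2n\<^sup>2 + n - 5)\<close>, then \<open>q\<close> is so close to \<open>l\<close> that the subgroup of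
  order \<open>q\<close> together with a few elements congruent to \<open>\<pm>1\<close> modulo \<open>p\<close> is a non-Ramanujan choice
  of \<open>T\<close>, and \<open>m\<close> is ordinary.
\<close>

section \<open>Prime values of quadratic polynomials\<close>

lemma tendsto_ln_power_over_self: "((\<lambda>x::real. ln x ^ r / x) \<longlongrightarrow> 0) at_top"
proof -
  have "((\<lambda>x::real. ln x ^ r / exp (ln x)) \<longlongrightarrow> 0) at_top"
    using filterlim_compose [OF tendsto_power_div_exp_0 ln_at_top] .
  moreover have "eventually (\<lambda>x::real. ln x ^ r / exp (ln x) = ln x ^ r / x) at_top"
    using eventually_gt_at_top [of 0] by eventually_elim simp
  ultimately show ?thesis
    by (rule Lim_transform_eventually)
qed

text \<open>
  No information on the constant is needed: if it vanished, the counting function would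
  eventually be zero, which a single witness rules out.
\<close>

lemma bateman_horn_imp_infinite:
  fixes fs :: "int poly list"
  assumes BH: "bateman_horn_conjecture"
    and fs: "fs \<noteq> []" "distinct fs" "\<And>f. f \<in> set fs \<Longrightarrow> irreducible f"
      "\<And>f. f \<in> set fs \<Longrightarrow> lead_coeff f > 0"
    and nofix: "\<And>l::nat. prime l \<Longrightarrow> \<exists>n>0. \<not> int l dvd poly (prod_list fs) (int n)"
    and witness: "n > 0" "\<And>f. f \<in> set fs \<Longrightarrow> prime (poly f (int n))"
  shows "infinite {n::nat. n > 0 \<and> (\<forall>f\<in>set fs. prime (poly f (int n)))}" (is "infinite ?A")
proof
  assume fin: "finite ?A"
  define K where "K = bateman_horn_const fs / real (\<Prod>f\<leftarrow>fs. degree f)"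
  define r where "r = length fs"
  define c where "c = card ?A"
  have "n \<in> ?A" using witness by simp
  hence "c > 0" using fin unfolding c_def card_gt_0_iff by blast
  have "(\<lambda>x::real. real (card {n::nat. n > 0 \<and> real n \<le> x \<and>
      (\<forall>f \<in> set fs. prime (poly f (int n)))})) \<sim>[at_top] (\<lambda>x. K * (x / ln x ^ r))"
    unfolding K_def r_def
    by (rule BH [unfolded bateman_horn_conjecture_def, rule_format]) (use fs nofix in blast)
  moreover have "eventually (\<lambda>x::real. real (card {n::nat. n > 0 \<and> real n \<le> x \<and>
      (\<forall>f \<in> set fs. prime (poly f (int n)))}) = real c) at_top"
    using eventually_ge_at_top [of "real (Max ?A)"]
  proof eventually_elim
    case (elim x)
    have "real n \<le> x" if "n \<in> ?A" for n
      using Max_ge [OF fin that] elim by linarith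
    hence "{n::nat. n > 0 \<and> real n \<le> x \<and> (\<forall>f \<in> set fs. prime (poly f (int n)))} = ?A"
      by blast
    thus ?case by (simp add: c_def)
  qed
  ultimately have eq: "(\<lambda>_. real c) \<sim>[at_top] (\<lambda>x. K * (x / ln x ^ r))"
    by (rule asymp_equiv_transfer [OF _ _ always_eventually]) simp
  hence lim: "((\<lambda>x. K * (x / ln x ^ r)) \<longlongrightarrow> real c) at_top"
    by (rule asymp_equiv_tendsto_transfer) simp
  \<comment> \<open>A finite limit contradicts the growth of \<open>x / ln x ^ r\<close> unless
    \<open>K = 0\<close>; the counting function would then be asymptotic to 0, against
    \<open>c > 0\<close>.\<close>
  have "((\<lambda>x. K * (x / ln x ^ r) * (ln x ^ r / x)) \<longlongrightarrow> 0) at_top"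
    using tendsto_mult [OF lim tendsto_ln_power_over_self [of r]] by simp
  moreover have "eventually (\<lambda>x. K * (x / ln x ^ r) * (ln x ^ r / x) = K) at_top"
    using eventually_gt_at_top [of 1] by eventually_elim auto
  ultimately have "((\<lambda>_::real. K) \<longlongrightarrow> 0) at_top"
    by (rule Lim_transform_eventually)
  hence "K = 0" by (simp add: tendsto_const_iff)
  thus False using eq \<open>c > 0\<close> by simp
qed

section \<open>Irreducibility of the quadratics\<close>

text \<open>A constant factor divides both outer coefficients and so is a unit; a splitting into two
  linear factors makes the discriminant the square of their resultant.\<close>

lemma irreducible_int_quadratic:
  fixes A B C :: int
  assumes "A \<noteq> 0" "coprime A C" and disc: "\<And>s. s\<^sup>2 \<noteq> B\<^sup>2 - 4 * A * C"
  shows "irreducible [:C, B, A:]"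
proof (rule irreducibleI)
  show "[:C, B, A:] \<noteq> 0" using assms by simp
  show "\<not> [:C, B, A:] dvd 1"
    using assms by (auto simp: is_unit_poly_iff)
  fix f g assume fg: "[:C, B, A:] = f * g"
  have nz: "f \<noteq> 0" "g \<noteq> 0" using fg \<open>A \<noteq> 0\<close> by auto
  have deg: "degree f + degree g = 2"
    using degree_mult_eq [OF nz] \<open>A \<noteq> 0\<close> by (simp flip: fg)
  have const: "h dvd 1" if h: "h dvd [:C, B, A:]" "degree h = 0" for h
  proof -
    obtain c where c: "h = [:c:]" using h(2) degree_eq_zeroE by blast
    hence "c dvd coeff [:C, B, A:] i" for i using h(1) by (simp add: const_poly_dvd_iff)
    from this [of 0] this [of 2] have "c dvd C" "c dvd A" by (simp_all add: numeral_2_eq_2)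
    hence "c dvd 1" using \<open>coprime A C\<close> coprime_common_divisor by blast
    thus ?thesis using c by (simp add: is_unit_const_poly_iff)
  qed
  consider "degree f = 0" | "degree g = 0" | "degree f = 1" "degree g = 1"
    using deg by linarith
  thus "f dvd 1 \<or> g dvd 1"
  proof cases
    case 3
    obtain a0 a1 where f: "f = [:a0, a1:]" using 3(1) degree1_coeffs by blast
    obtain b0 b1 where g: "g = [:b0, b1:]" using 3(2) degree1_coeffs by blast
    have "C = a0 * b0" "B = a0 * b1 + a1 * b0" "A = a1 * b1"
      using fg unfolding f g by simp_all
    hence "B\<^sup>2 - 4 * A * C = (a0 * b1 - a1 * b0)\<^sup>2"
      by (simp add: power2_eq_square algebra_simps)
    thus ?thesis using disc by metis
  next
    case 1 thus ?thesis using const [of f] fg by (metis dvd_triv_left)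
  next
    case 2 thus ?thesis using const [of g] fg by (metis dvd_triv_right)
  qed
qed

lemma int_square_neq_between:
  fixes s t :: int assumes "0 \<le> t" "t\<^sup>2 < d" "d < (t + 1)\<^sup>2" shows "s\<^sup>2 \<noteq> d"
proof
  assume "s\<^sup>2 = d"
  hence "t\<^sup>2 < \<bar>s\<bar>\<^sup>2" "\<bar>s\<bar>\<^sup>2 < (t + 1)\<^sup>2" using assms by simp_all
  hence "t < \<bar>s\<bar>" "\<bar>s\<bar> < t + 1"
    using assms(1) power2_less_imp_less [of t "\<bar>s\<bar>"] power2_less_imp_less [of "\<bar>s\<bar>" "t + 1"]
    by linarith+
  thus False by linarith
qed

lemma irreducible_quadratics:
  "irreducible [:5, 5, 1::int:]" "irreducible [:11, 7, 1::int:]"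
  "irreducible [:-1, 1, 1::int:]" "irreducible [:-5, 0, 4::int:]"
proof -
  \<comment> \<open>The first three polynomials have discriminant 5, the last has 80; these lie
    strictly between \<open>2^2\<close> and \<open>3^2\<close>, and between \<open>8^2\<close> and
    \<open>9^2\<close>.\<close>
  have 5: "s\<^sup>2 \<noteq> 5" and 80: "s\<^sup>2 \<noteq> 80" for s :: int
    by (rule int_square_neq_between [of 2], simp_all) (rule int_square_neq_between [of 8], simp_all)
  show "irreducible [:5, 5, 1::int:]" "irreducible [:11, 7, 1::int:]"
       "irreducible [:-1, 1, 1::int:]"
    by (rule irreducible_int_quadratic; simp add: 5)+
  have "coprime (4::int) 5" using coprime_add_one_right [of "4::int"] by simp
  thus "irreducible [:-5, 0, 4::int:]"
    by (intro irreducible_int_quadratic) (simp_all add: 80)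
qed

lemma prime_poly_int_iff:
  assumes "poly f (int n) = int v"
  shows "prime (poly f (int n)) \<longleftrightarrow> prime v"
  by (simp add: assms)

section \<open>Infinitely many prime values\<close>

lemma infinite_prime_values:
  assumes BH: "bateman_horn_conjecture"
  shows "infinite {n::nat. n > 0 \<and> prime (n\<^sup>2 + 5 * n + 5)}"
proof -
  have val: "poly [:5, 5, 1:] (int n) = int (n\<^sup>2 + 5 * n + 5)" for n
    by (simp add: power2_eq_square algebra_simps)
  have "infinite {n::nat. n > 0 \<and> (\<forall>f\<in>set [[:5, 5, 1:]]. prime (poly f (int n)))}"
  proof (rule bateman_horn_imp_infinite [OF BH, of _ 1])
    fix l :: nat assume l: "prime l"
    show "\<exists>n>0. \<not> int l dvd poly (prod_list [[:5, 5, 1:]]) (int n)"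
    proof (rule ccontr)
      assume "\<not> ?thesis"
      hence *: "int l dvd poly (prod_list [[:5, 5, 1:]]) (int n)" if "n > 0" for n using that by blast
      have "int l dvd 11" using * [of 1] by simp
      moreover have "int l dvd 19" using * [of 2] by simp
      \<comment> \<open>The values 11 and 19 at 1 and 2 are coprime; this combination equals
        1.\<close>
      ultimately have "int l dvd 7 * 11 - 4 * 19" by (intro dvd_diff dvd_mult)
      thus False using l by simp
    qed
  qed (use irreducible_quadratics in auto)
  thus ?thesis unfolding list.set ball_simps prime_poly_int_iff [OF val] by simp
qed

lemma infinite_consecutive_prime_values:
  assumes BH: "bateman_horn_conjecture"
  shows "infinite {n::nat. n > 0 \<and> prime (n\<^sup>2 + 5 * n + 5) \<and> prime (n\<^sup>2 + 7 * n + 11)}"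
proof -
  have val: "poly [:5, 5, 1:] (int n) = int (n\<^sup>2 + 5 * n + 5)"
     "poly [:11, 7, 1:] (int n) = int (n\<^sup>2 + 7 * n + 11)" for n
    by (simp_all add: power2_eq_square algebra_simps)
  have "infinite {n::nat. n > 0 \<and> (\<forall>f\<in>set [[:5, 5, 1:], [:11, 7, 1:]]. prime (poly f (int n)))}"
  proof (rule bateman_horn_imp_infinite [OF BH, of _ 1])
    fix l :: nat assume l: "prime l"
    show "\<exists>n>0. \<not> int l dvd poly (prod_list [[:5, 5, 1:], [:11, 7, 1:]]) (int n)"
    proof (rule ccontr)
      assume "\<not> ?thesis"
      hence *: "int l dvd poly (prod_list [[:5, 5, 1:], [:11, 7, 1:]]) (int n)" if "n > 0" for n using that by blast
      have "int l dvd 209" using * [of 1] by simp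
      moreover have "int l dvd 1189" using * [of 3] by simp
      \<comment> \<open>The products \<open>11 * 19\<close> at 1 and \<open>29 * 41\<close> at 3 are
        coprime; this combination equals 1.\<close>
      ultimately have "int l dvd 933 * 209 - 164 * 1189"
        by (intro dvd_diff dvd_mult)
      thus False using l by simp
    qed
  qed (use irreducible_quadratics in auto)
  thus ?thesis unfolding list.set ball_simps prime_poly_int_iff [OF val(1)] prime_poly_int_iff [OF val(2)] by simp
qed

lemma infinite_unbalanced_prime_values:
  assumes BH: "bateman_horn_conjecture"
  shows "infinite {n::nat. n > 1 \<and> prime (n\<^sup>2 + n - 1) \<and> prime (4 * n\<^sup>2 - 5)}"
proof -
  have val: "poly [:-1, 1, 1:] (int n) = int (n\<^sup>2 + n - 1)"
     "poly [:-5, 0, 4:] (int n) = int (4 * n\<^sup>2 - 5)" if "n > 1" for n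
  proof -
    have "n\<^sup>2 \<ge> 2 * 2" unfolding power2_eq_square using that by (intro mult_le_mono) auto
    thus "poly [:-1, 1, 1:] (int n) = int (n\<^sup>2 + n - 1)"
     "poly [:-5, 0, 4:] (int n) = int (4 * n\<^sup>2 - 5)"
      by (simp_all add: of_nat_diff power2_eq_square algebra_simps)
  qed
  have "infinite {n::nat. n > 0 \<and> (\<forall>f\<in>set [[:-1, 1, 1:], [:-5, 0, 4:]]. prime (poly f (int n)))}"
    (is "infinite ?A")
  \<comment> \<open>The witness 2 gives the primes 5 and 11. A fixed prime divisor is excluded at 1,
    where the product is -1.\<close>
  proof (rule bateman_horn_imp_infinite [OF BH, of _ 2])
    fix l :: nat assume l: "prime l"
    show "\<exists>n>0. \<not> int l dvd poly (prod_list [[:-1, 1, 1:], [:-5, 0, 4:]]) (int n)"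
      by (rule exI [of _ 1]) (use l in \<open>simp add: prime_nat_iff\<close>)
  qed (use irreducible_quadratics in auto)
  \<comment> \<open>At 1 the natural number \<open>4 * n^2 - 5\<close> is truncated to 0, whereas
    the polynomial takes the value -1.\<close>
  hence "infinite (?A - {1})" by simp
  moreover have "?A - {1} \<subseteq> {n::nat. n > 1 \<and> prime (n\<^sup>2 + n - 1) \<and> prime (4 * n\<^sup>2 - 5)}"
  proof
    fix n assume n: "n \<in> ?A - {1}"
    hence "n > 0" "n \<noteq> 1" by blast+
    hence "n > 1" by linarith
    thus "n \<in> {n::nat. n > 1 \<and> prime (n\<^sup>2 + n - 1) \<and> prime (4 * n\<^sup>2 - 5)}"
      using n by (simp only: prime_poly_int_iff [OF val(1)] prime_poly_int_iff [OF val(2)]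
        list.set ball_simps mem_Collect_eq Diff_iff)
  qed
  ultimately show ?thesis using finite_subset by blast
qed

section \<open>Cosine sums over complements of Cayley subsets\<close>

lemma cos_ge_one_minus_half_square: "1 - x\<^sup>2 / 2 \<le> cos (x::real)"
proof -
  have "cos x = 1 - 2 * (sin (x / 2))\<^sup>2"
    using cos_double_sin [of "x / 2"] by simp
  moreover have "(sin (x / 2))\<^sup>2 \<le> (x / 2)\<^sup>2"
    using abs_sin_x_le_abs_x [of "x / 2"] by (simp only: abs_le_square_iff)
  ultimately show ?thesis by (simp add: power_divide)
qed

text \<open>Jordan's inequality, from the concavity of the sine on \<open>[0, \<pi>]\<close>.\<close>

lemma sin_pi_ge:
  fixes D x :: real
  assumes D: "0 \<le> D" and x: "D \<le> x" "x \<le> 1 - D"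
  shows "2 * D \<le> sin (pi * x)"
proof -
  have half: "2 * y \<le> sin (pi * y)" if y: "0 \<le> y" "y \<le> 1 / 2" for y
  proof -
    have "convex_on {0..pi} (\<lambda>x. - sin x)"
      by (rule f''_ge0_imp_convex [where f' = "\<lambda>x. - cos x" and f'' = sin])
         (auto intro!: derivative_eq_intros sin_ge_zero)
    from convex_onD [OF this, of "2 * y" 0 "pi / 2"]
    show ?thesis using y by (simp add: mult.commute)
  qed
  show ?thesis
  proof (cases "x \<le> 1 / 2")
    case True
    thus ?thesis using half [of x] D x by linarith
  next
    case False
    have "sin (pi * (1 - x)) = sin (pi * x)"
      by (simp add: right_diff_distrib sin_diff)
    moreover have "0 \<le> 1 - x" "1 - x \<le> 1 / 2" using D x False by linarith+
    ultimately have "2 * (1 - x) \<le> sin (pi * x)" using half [of "1 - x"] by metis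
    moreover have "2 * D \<le> 2 * (1 - x)" using x by simp
    ultimately show ?thesis by (rule order_trans [rotated])
  qed
qed

text \<open>Measures what a term costs a cosine sum when its phase \<open>x\<close> keeps distance
  \<open>D\<close> from the integers: the loss is twice the square of
  \<open>sin (pi * x)\<close>.\<close>

lemma one_minus_cos_ge:
  fixes D x :: real
  assumes "0 \<le> D" "D \<le> x" "x \<le> 1 - D"
  shows "8 * D\<^sup>2 \<le> 1 - cos (2 * pi * x)"
proof -
  have "(2 * D)\<^sup>2 \<le> (sin (pi * x))\<^sup>2"
    using sin_pi_ge [OF assms] assms(1) by (intro power_mono) auto
  moreover have "cos (2 * pi * x) = 1 - 2 * (sin (pi * x))\<^sup>2"
    using cos_double_sin [of "pi * x"] by (simp add: mult.assoc)
  ultimately show ?thesis by (simp add: power_mult_distrib)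
qed

section \<open>Eigenvalues in terms of the complement\<close>

text \<open>The real part of the character of frequency \<open>j\<close> at \<open>a\<close>; over
  symmetric sets the imaginary parts cancel.\<close>

definition circ_cos :: "nat \<Rightarrow> nat \<Rightarrow> int \<Rightarrow> real" where
  "circ_cos m j a = cos (2 * pi * (of_int (a * int j) / of_nat m))"

lemma circ_cos_eq:
  assumes "m > 0" "[a * int j = r] (mod int m)"
  shows "circ_cos m j a = cos (2 * pi * (of_int r / of_nat m))"
proof -
  obtain k where "a * int j = r + int m * k"
    using assms(2) by (metis cong_iff_lin cong_sym)
  hence "of_int (a * int j) / of_nat m = of_int r / real m + of_int k"
    using assms(1) by (simp add: field_simps)
  hence "circ_cos m j a = cos (2 * pi * (of_int r / of_nat m) + of_int k * (2 * pi))"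
    unfolding circ_cos_def by (simp add: algebra_simps)
  also have "\<dots> = cos (2 * pi * (of_int r / of_nat m))"
    by (simp add: cos_add mult.commute [of _ "2 * pi"])
  finally show ?thesis .
qed

lemma circ_cos_le_1: "circ_cos m j a \<le> 1"
  by (simp add: circ_cos_def)

lemma circ_cos_0 [simp]: "circ_cos m j 0 = 1"
  by (simp add: circ_cos_def)

lemma circ_cos_abs_le_1: "\<bar>circ_cos m j a\<bar> \<le> 1"
  by (simp add: circ_cos_def)

text \<open>The complements of Cayley subsets, apart from the generating condition, which
  \<open>cayley_subset_of_complement\<close> recovers from a size bound.\<close>

definition sym_subset :: "nat \<Rightarrow> int set \<Rightarrow> bool" where
  "sym_subset m T \<longleftrightarrow> T \<subseteq> {0..<int m} \<and> 0 \<in> T \<and> (\<forall>a\<in>T. (- a) mod int m \<in> T)"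

lemma uminus_mod_mod: "a \<in> {0..<int m} \<Longrightarrow> (- ((- a) mod int m)) mod int m = a"
  by (simp add: mod_minus_eq)

text \<open>Orthogonality of characters turns the sum over the Cayley subset into minus the sum over
  \<open>T\<close>, and the symmetry of \<open>T\<close> makes the latter real.\<close>

lemma cayley_eigenvalue_complement:
  assumes m: "0 < j" "j < m" and T: "sym_subset m T"
  shows "cayley_eigenvalue m ({0..<int m} - T) j = - of_real (\<Sum>a\<in>T. circ_cos m j a)"
proof -
  define e where "e a = cis (2 * pi * (of_int (a * int j) / of_nat m))" for a :: int
  have m0: "m > 0" using m by simp
  have exp_e: "exp (2 * of_real pi * \<i> * of_int a * of_nat j / of_nat m) = e a" for a
    by (simp add: e_def cis_conv_exp mult_ac)
  have T': "T \<subseteq> {0..<int m}" using T by (simp add: sym_subset_def)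
  hence fin: "finite T" by (rule finite_subset) simp
  \<comment> \<open>All character values are powers of \<open>w\<close>, an \<open>m\<close>-th root
    of unity different from 1 because \<open>0 < j / m < 1\<close>; so they sum to 0 over the whole
    group.\<close>
  define w where "w = cis (2 * pi * (of_nat j / of_nat m))"
  have e_int: "e (int n) = w ^ n" for n
    by (simp only: e_def w_def Complex.DeMoivre) (simp add: mult_ac)
  have "w \<noteq> 1"
  proof
    assume "w = 1"
    hence "cos (2 * pi * (of_nat j / of_nat m)) = 1" by (simp add: w_def complex_eq_iff)
    then obtain n :: int where "2 * pi * (of_nat j / of_nat m) = of_int n * 2 * pi"
      unfolding cos_one_2pi_int by blast
    hence "(2 * pi) * (real j / real m) = (2 * pi) * of_int n" by (simp only: mult_ac)
    hence "real j / real m = of_int n" by (subst (asm) mult_cancel_left) simp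
    moreover have "0 < real j / real m" "real j / real m < 1" using m by simp_all
    ultimately show False by simp
  qed
  moreover have "w ^ m = 1"
  proof -
    have "w ^ m = cis (2 * pi * real j)"
      using m0 unfolding w_def Complex.DeMoivre by simp
    thus ?thesis using cis_multiple_2pi [of "real j"] by simp
  qed
  ultimately have "(\<Sum>n<m. w ^ n) = 0" by (simp add: geometric_sum)
  moreover have "(\<Sum>a\<in>{0..<int m}. e a) = (\<Sum>n<m. w ^ n)"
    by (rule sum.reindex_bij_witness [of _ int nat]) (auto simp flip: e_int)
  ultimately have all: "(\<Sum>a\<in>{0..<int m}. e a) = 0" by simp
  have "cayley_eigenvalue m ({0..<int m} - T) j = (\<Sum>a\<in>{0..<int m} - T. e a)"
    by (simp add: cayley_eigenvalue_def exp_e)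
  also have "\<dots> = - (\<Sum>a\<in>T. e a)"
    using sum_diff [OF _ T', of e] all by simp
  also have "(\<Sum>a\<in>T. e a) = of_real (\<Sum>a\<in>T. circ_cos m j a)"
  proof -
    define s where "s a = sin (2 * pi * (of_int (a * int j) / of_nat m))" for a
    \<comment> \<open>Negation permutes \<open>T\<close> and changes the sign of \<open>s\<close>,
      so the sines cancel.\<close>
    have neg: "s ((- a) mod int m) = - s a" for a
    proof -
      have eq: "of_int ((- a) mod int m) = - of_int a - real m * of_int ((- a) div int m)"
        by (simp only: flip: minus_mult_div_eq_mod) simp
      have "2 * pi * (of_int ((- a) mod int m * int j) / of_nat m) =
          - (2 * pi * (of_int (a * int j) / of_nat m)) - 2 * pi * of_int (((- a) div int m) * int j)"
        unfolding of_int_mult eq using m0 by (simp add: field_simps)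
      thus ?thesis unfolding s_def
        by (simp only: sin_diff sin_int_2pin cos_int_2pin) simp
    qed
    have "(\<Sum>a\<in>T. s a) = (\<Sum>a\<in>T. s ((- a) mod int m))"
      using T T' uminus_mod_mod
      by (intro sum.reindex_bij_witness [of T "\<lambda>a. (- a) mod int m" "\<lambda>a. (- a) mod int m"])
         (auto simp: sym_subset_def subset_iff)
    also have "\<dots> = - (\<Sum>a\<in>T. s a)" by (simp add: neg sum_negf)
    finally have "(\<Sum>a\<in>T. s a) = 0" by simp
    thus ?thesis
      by (simp add: complex_eq_iff e_def circ_cos_def s_def)
  qed
  finally show ?thesis .
qed

text \<open>The working form of the Ramanujan property: \<open>T\<close> alone enters, in the sums
  and, through \<open>card S = m - card T\<close>, in the bound.\<close>

lemma cayley_ramanujan_complement_iff: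
  assumes m: "m \<ge> 2" and T: "sym_subset m T"
  shows "cayley_ramanujan m ({0..<int m} - T) \<longleftrightarrow>
    (\<forall>j. 0 < j \<and> j < m \<longrightarrow>
      \<bar>\<Sum>a\<in>T. circ_cos m j a\<bar> \<le> 2 * sqrt (real m - real (card T) - 1))"
proof -
  have T': "T \<subseteq> {0..<int m}" using T by (simp add: sym_subset_def)
  have "card ({0..<int m} - T) = m - card T"
    using T' by (simp add: card_Diff_subset finite_subset)
  moreover have "card T \<le> m" using card_mono [OF _ T'] by simp
  ultimately have "real (card ({0..<int m} - T)) - 1 = real m - real (card T) - 1"
    by simp
  moreover have "cmod (cayley_eigenvalue m ({0..<int m} - T) j) = \<bar>\<Sum>a\<in>T. circ_cos m j a\<bar>"
    if "0 < j" "j < m" for j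
    by (simp only: cayley_eigenvalue_complement [OF that T] norm_minus_cancel norm_of_real)
  moreover have "{1..m - 1} \<noteq> {}" using m by simp
  moreover have "j \<in> {1..m - 1} \<longleftrightarrow> 0 < j \<and> j < m" for j using m by auto
  ultimately show ?thesis
    unfolding cayley_ramanujan_def cayley_mu_def by (subst Max_le_iff) auto
qed

lemma cayley_subset_complement:
  assumes m: "m > 0" and S: "cayley_subset m S"
  shows "sym_subset m ({0..<int m} - S)" "S = {0..<int m} - ({0..<int m} - S)"
    "card ({0..<int m} - S) = covalency m S"
proof -
  have S': "S \<subseteq> {0..<int m}" "0 \<notin> S"
    using S m by (auto simp: cayley_subset_def carrier_integer_mod_group)
  have "(\<lambda>a. (- a) mod int m) ` S = (\<lambda>a. inv\<^bsub>integer_mod_group m\<^esub> a) ` S"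
    using S' m by (intro image_cong) (auto simp: carrier_integer_mod_group)
  hence inv: "(\<lambda>a. (- a) mod int m) ` S = S" using S by (simp add: cayley_subset_def)
  have "(- a) mod int m \<notin> S" if a: "a \<in> {0..<int m} - S" for a
  proof
    assume "(- a) mod int m \<in> S"
    hence "(- ((- a) mod int m)) mod int m \<in> S" using inv by blast
    thus False using a uminus_mod_mod [of a m] by simp
  qed
  thus "sym_subset m ({0..<int m} - S)" using S' m by (simp add: sym_subset_def)
  show "S = {0..<int m} - ({0..<int m} - S)" using S' by blast
  show "card ({0..<int m} - S) = covalency m S"
    using S' by (simp add: covalency_def card_Diff_subset finite_subset)
qed

text \<open>The complement of a small set generates the group because it has more than half its elements.\<close>

lemma cayley_subset_of_complement:
  assumes T: "sym_subset m T" and small: "2 * card T < m"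
  shows "cayley_subset m ({0..<int m} - T)" "covalency m ({0..<int m} - T) = card T"
proof -
  define S where "S = {0..<int m} - T"
  define G where "G = integer_mod_group m"
  have m: "m > 0" using small by simp
  have T': "T \<subseteq> {0..<int m}" using T by (simp add: sym_subset_def)
  have cG: "carrier G = {0..<int m}" using m by (simp add: G_def carrier_integer_mod_group)
  interpret group G unfolding G_def by simp
  have cardS: "card S = m - card T"
    using T' by (simp add: S_def card_Diff_subset finite_subset)
  show "covalency m ({0..<int m} - T) = card T"
    using cardS small unfolding covalency_def S_def by simp
  have neg: "(- a) mod int m \<in> S" if "a \<in> S" for a
    using that T uminus_mod_mod [of a m] m by (auto simp: S_def sym_subset_def)
  have "(\<lambda>a. inv\<^bsub>G\<^esub> a) ` S = (\<lambda>a. (- a) mod int m) ` S"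
    using m by (intro image_cong) (auto simp: S_def G_def carrier_integer_mod_group)
  also have "\<dots> = S"
  proof (intro equalityI subsetI)
    fix a assume "a \<in> S"
    hence "a = (- ((- a) mod int m)) mod int m" using uminus_mod_mod [of a m] by (simp add: S_def)
    thus "a \<in> (\<lambda>a. (- a) mod int m) ` S" using neg [OF \<open>a \<in> S\<close>] by blast
  qed (use neg in auto)
  finally have inv: "(\<lambda>a. inv\<^bsub>G\<^esub> a) ` S = S" .
  have SG: "S \<subseteq> carrier G" unfolding cG S_def by blast
  have sub: "subgroup (generate G S) G" using SG by (rule generate_is_subgroup)
  have "card (rcosets\<^bsub>G\<^esub> (generate G S)) * card (generate G S) = order G"
    using lagrange [OF sub] .
  moreover have "order G = m" by (simp add: order_def cG)
  moreover have gen: "generate G S \<subseteq> carrier G" using sub by (rule subgroup.subset)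
  moreover have "card S \<le> card (generate G S)"
    using gen cG by (intro card_mono generate.incl subsetI) (auto intro: finite_subset)
  ultimately have prod: "card (rcosets\<^bsub>G\<^esub> (generate G S)) * card (generate G S) = m"
    and big: "m < 2 * card (generate G S)"
    using cardS small by linarith+
  \<comment> \<open>By Lagrange the index times the order of the generated subgroup is
    \<open>m\<close>, and the order exceeds \<open>m / 2\<close>.\<close>
  have "card (rcosets\<^bsub>G\<^esub> (generate G S)) < 2"
  proof (rule ccontr)
    assume "\<not> ?thesis"
    hence "2 * card (generate G S) \<le> card (rcosets\<^bsub>G\<^esub> (generate G S)) * card (generate G S)"
      by (intro mult_le_mono1) simp
    thus False using prod big by linarith
  qed
  moreover have "card (rcosets\<^bsub>G\<^esub> (generate G S)) \<noteq> 0" using prod m by auto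
  ultimately have "card (rcosets\<^bsub>G\<^esub> (generate G S)) = 1" by linarith
  hence "card (generate G S) = card (carrier G)" using prod by (simp add: cG)
  hence "generate G S = carrier G"
    using gen by (intro card_subset_eq) (simp_all add: cG)
  thus "cayley_subset m ({0..<int m} - T)"
    using inv SG T unfolding cayley_subset_def S_def [symmetric] G_def [symmetric]
    by (auto simp: S_def sym_subset_def)
qed

text \<open>For odd \<open>m\<close>, negation fixes only 0; the other elements pair up as
  \<open>a\<close> and \<open>m - a\<close>, on opposite sides of \<open>m / 2\<close>.\<close>

lemma odd_card_sym_subset:
  assumes m: "odd m" and T: "sym_subset m T"
  shows "odd (card T)"
proof -
  have T': "T \<subseteq> {0..<int m}" "0 \<in> T" and neg: "\<And>a. a \<in> T \<Longrightarrow> (- a) mod int m \<in> T"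
    using T by (auto simp: sym_subset_def)
  have fin: "finite T" using T'(1) by (rule finite_subset) simp
  have minus: "(- a) mod int m = int m - a" if "0 < a" "a < int m" for a
    using that by (simp add: zmod_zminus1_eq_if)
  define A where "A = {a\<in>T. 0 < a \<and> 2 * a < int m}"
  define B where "B = {a\<in>T. int m < 2 * a}"
  have "a = 0 \<or> a \<in> A \<or> a \<in> B" if "a \<in> T" for a
  proof -
    have "2 * a \<noteq> int m" using m by presburger
    moreover have "0 \<le> a" using that T' by auto
    ultimately show ?thesis using that unfolding A_def B_def by simp linarith
  qed
  hence "T = {0} \<union> (A \<union> B)" using T' by (auto simp: A_def B_def)
  hence "card T = card ({0} \<union> (A \<union> B))" by simp
  also have "\<dots> = 1 + (card A + card B)"
    using fin by (subst card_Un_disjoint; (subst card_Un_disjoint)?) (auto simp: A_def B_def)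
  also have "card A = card B"
  proof (rule bij_betw_same_card, rule bij_betw_byWitness
      [where f = "\<lambda>a. int m - a" and f' = "\<lambda>a. int m - a"])
    show "\<forall>a\<in>A. int m - (int m - a) = a" "\<forall>a\<in>B. int m - (int m - a) = a" by simp_all
    show "(\<lambda>a. int m - a) ` A \<subseteq> B"
      using neg minus T' by (force simp: A_def B_def)
    show "(\<lambda>a. int m - a) ` B \<subseteq> A"
      using neg minus T' by (force simp: A_def B_def)
  qed
  finally show ?thesis by simp
qed

text \<open>Covalencies are odd, so it suffices to look two steps ahead.\<close>

lemma l_hat_eqI:
  assumes m: "odd m"
    and S: "cayley_subset m S" "covalency m S = l"
    and ram: "\<And>S. cayley_subset m S \<Longrightarrow> covalency m S \<le> l \<Longrightarrow> cayley_ramanujan m S"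
    and S': "cayley_subset m S'" "covalency m S' = l + 2" "\<not> cayley_ramanujan m S'"
  shows "l_hat m = l"
  unfolding l_hat_def
proof (rule Max_eqI)
  have m0: "m > 0" using m by (rule odd_pos)
  have odd_cov: "odd (covalency m S)" if "cayley_subset m S" for S
    using odd_card_sym_subset [OF m cayley_subset_complement(1) [OF m0 that]]
      cayley_subset_complement(3) [OF m0 that] by simp
  let ?L = "{l. (\<exists>S. cayley_subset m S \<and> covalency m S = l) \<and>
    (\<forall>S. cayley_subset m S \<and> covalency m S \<le> l \<longrightarrow> cayley_ramanujan m S)}"
  show le: "k \<le> l" if k: "k \<in> ?L" for k
  proof -
    have "\<not> l + 2 \<le> k" using k S' by auto
    moreover have "odd k" "odd l" using k odd_cov S by auto
    ultimately show ?thesis by presburger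
  qed
  show "finite ?L" using le by (intro finite_subset [of ?L "{..l}"]) auto
  show "l \<in> ?L" using S ram by auto
qed

text \<open>The trivial bound \<open>l\<close> on the cosine sum already suffices:
  \<open>l^2 <= 4 * (m - l - 1)\<close> is equivalent to \<open>(l + 2)^2 <= 4 * m\<close>.\<close>

lemma cayley_ramanujan_small_covalency:
  assumes m: "m \<ge> 2" and S: "cayley_subset m S" and l: "(covalency m S + 2)\<^sup>2 \<le> 4 * m"
  shows "cayley_ramanujan m S"
proof -
  have m0: "m > 0" using m by simp
  define T where "T = {0..<int m} - S"
  note T = cayley_subset_complement [OF m0 S, folded T_def]
  have "\<bar>\<Sum>a\<in>T. circ_cos m j a\<bar> \<le> 2 * sqrt (real m - real (card T) - 1)" for j
  proof -
    have "\<bar>\<Sum>a\<in>T. circ_cos m j a\<bar> \<le> (\<Sum>a\<in>T. 1)"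
      by (rule order_trans [OF sum_abs]) (intro sum_mono circ_cos_abs_le_1)
    also have "\<dots> = sqrt ((real (card T))\<^sup>2)" by simp
    also have "\<dots> \<le> sqrt (2\<^sup>2 * (real m - real (card T) - 1))"
    proof (rule real_sqrt_le_mono)
      have "real ((card T + 2)\<^sup>2) \<le> real (4 * m)" using l T(3) by (simp only: of_nat_le_iff)
      thus "(real (card T))\<^sup>2 \<le> 2\<^sup>2 * (real m - real (card T) - 1)"
        by (simp add: power2_eq_square algebra_simps)
    qed
    also have "\<dots> = 2 * sqrt (real m - real (card T) - 1)" by (simp only: real_sqrt_mult real_sqrt_abs abs_numeral)
    finally show ?thesis .
  qed
  thus ?thesis using cayley_ramanujan_complement_iff [OF m T(1)] T(2) by simp
qed

section \<open>Exceptional moduli\<close>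

text \<open>The integers of absolute value at most \<open>h\<close>, reduced modulo
  \<open>m\<close>.\<close>

definition sym_interval :: "nat \<Rightarrow> nat \<Rightarrow> int set" where
  "sym_interval m h = {0..int h} \<union> {int m - int h..<int m}"

lemma sym_interval:
  assumes "2 * h < m"
  shows "sym_subset m (sym_interval m h)" "card (sym_interval m h) = 2 * h + 1"
proof -
  show "sym_subset m (sym_interval m h)"
    using assms by (auto simp: sym_subset_def sym_interval_def zmod_zminus1_eq_if)
  have "card (sym_interval m h) = card {0..int h} + card {int m - int h..<int m}"
    unfolding sym_interval_def using assms by (intro card_Un_disjoint) auto
  thus "card (sym_interval m h) = 2 * h + 1" by simp
qed

text \<open>The constant 32 is \<open>8^2 / 2\<close>, from \<open>cos y >= 1 - y^2 / 2\<close> and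
  \<open>2 * pi < 8\<close>.\<close>

lemma circ_cos_ge:
  assumes m: "m > 0" and r: "[a * int j = r] (mod int m)" "\<bar>of_int r / real m\<bar> \<le> x"
  shows "1 - 32 * x\<^sup>2 \<le> circ_cos m j a"
proof -
  let ?y = "of_int r / real m"
  have "1 - (2 * pi * ?y)\<^sup>2 / 2 \<le> circ_cos m j a"
    unfolding circ_cos_eq [OF m r(1)] by (rule cos_ge_one_minus_half_square)
  moreover have "(2 * pi * ?y)\<^sup>2 \<le> (8 * x)\<^sup>2"
  proof (subst abs_le_square_iff [symmetric])
    have "\<bar>2 * pi * ?y\<bar> = (2 * pi) * \<bar>?y\<bar>" by (simp add: abs_mult)
    also have "\<dots> \<le> 8 * x" using r(2) pi_less_4 by (intro mult_mono) auto
    also have "\<dots> \<le> \<bar>8 * x\<bar>" by simp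
    finally show "\<bar>2 * pi * ?y\<bar> \<le> \<bar>8 * x\<bar>" .
  qed
  ultimately show ?thesis by (simp add: power_mult_distrib)
qed

text \<open>\<open>m\<close> is \<open>(k + 5/2)^2 - 5/4\<close>, so its root lies just below
  \<open>k + 5/2\<close> and the floor is \<open>k\<close>.\<close>

lemma l_zero_quadratic:
  assumes "m = k\<^sup>2 + 5 * k + 5"
  shows "l_zero m = 2 * int k + 1"
proof -
  have m: "real m = real k ^ 2 + 5 * real k + 5" using assms by simp
  have "real k + 3 / 2 \<le> sqrt (real m)"
    by (rule real_le_rsqrt) (simp add: m power2_eq_square algebra_simps)
  moreover have "sqrt (real m) < real k + 5 / 2"
    by (rule real_less_lsqrt) (simp_all add: m power2_eq_square algebra_simps)
  ultimately have "\<lfloor>sqrt (real m) - 3 / 2\<rfloor> = int k"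
    by (intro floor_unique) simp_all
  thus ?thesis by (simp add: l_zero_def)
qed

text \<open>With \<open>l = 2 * k + 5\<close> the squared Ramanujan bound
  \<open>4 * (m - l - 1)\<close> equals \<open>(l - 2)^2 - 13\<close>, while the cosine sum at
  frequency 1 is at least \<open>l - 2\<close>.\<close>

lemma not_ramanujan_interval:
  assumes m: "m = k\<^sup>2 + 5 * k + 5" and k: "k \<ge> 100"
  shows "\<not> cayley_ramanujan m ({0..<int m} - sym_interval m (k + 2))"
proof -
  define l where "l = real (2 * k + 5)"
  have kk: "100 * k \<le> k\<^sup>2" using k by (simp add: power2_eq_square)
  have h: "2 * (k + 2) < m" using m kk k by simp
  hence m2: "m \<ge> 2" and m1: "1 < m" and m0: "m > 0" by simp_all
  let ?T = "sym_interval m (k + 2)"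
  let ?x = "real (k + 2) / real m"
  have ml: "4 * real m = l\<^sup>2 - 5"
    unfolding m l_def by (simp add: power2_eq_square algebra_simps)
  have cos_ge: "1 - 32 * ?x\<^sup>2 \<le> circ_cos m 1 a" if a: "a \<in> ?T" for a
  proof (cases "a \<le> int (k + 2)")
    case True
    thus ?thesis using a h m0
      by (intro circ_cos_ge [where r = a]) (auto simp: sym_interval_def divide_right_mono)
  next
    case False
    \<comment> \<open>The upper part of the interval is represented by the negative integers
      \<open>a - m\<close>.\<close>
    hence "\<bar>a - int m\<bar> \<le> int (k + 2)" using a by (auto simp: sym_interval_def)
    hence "\<bar>of_int (a - int m) :: real\<bar> \<le> real (k + 2)" by linarith
    thus ?thesis using m0
      by (intro circ_cos_ge [where r = "a - int m"])
         (auto simp: cong_iff_dvd_diff divide_right_mono)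
  qed
  have "?x\<^sup>2 \<le> 1 / real m"
  proof -
    have "(k + 2)\<^sup>2 \<le> m" unfolding m by (simp add: power2_eq_square algebra_simps)
    hence "real ((k + 2)\<^sup>2) \<le> real m" by (simp only: of_nat_le_iff)
    hence "real (k + 2) ^ 2 / real m ^ 2 \<le> real m / real m ^ 2"
      by (intro divide_right_mono) simp_all
    thus ?thesis using m0 by (simp add: power_divide power2_eq_square)
  qed
  moreover have "16 * l \<le> real m"
  proof -
    have "16 * (2 * k + 5) \<le> m" using m kk k by simp
    hence "real (16 * (2 * k + 5)) \<le> real m" by (simp only: of_nat_le_iff)
    thus ?thesis by (simp add: l_def)
  qed
  hence "l / real m \<le> 1 / 16" using m0 by (simp add: field_simps)
  moreover have "l * ?x\<^sup>2 \<le> l * (1 / real m)"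
    using calculation(1) by (intro mult_left_mono) (simp_all add: l_def)
  moreover have "l * (1 - 32 * ?x\<^sup>2) = l - 32 * (l * ?x\<^sup>2)" by (simp only: right_diff_distrib)
  moreover have "l * (1 / real m) = l / real m" by simp
  \<comment> \<open>The total loss is at most \<open>32 * l / m\<close>, hence at most 2.\<close>
  ultimately have "l - 2 \<le> l * (1 - 32 * ?x\<^sup>2)" by linarith
  also have "l * (1 - 32 * ?x\<^sup>2) = (\<Sum>a\<in>?T. 1 - 32 * ?x\<^sup>2)"
    using sym_interval(2) [OF h] by (simp add: l_def)
  also have "\<dots> \<le> (\<Sum>a\<in>?T. circ_cos m 1 a)" by (intro sum_mono cos_ge)
  also have "\<dots> \<le> \<bar>\<Sum>a\<in>?T. circ_cos m 1 a\<bar>" by simp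
  finally have ge: "l - 2 \<le> \<bar>\<Sum>a\<in>?T. circ_cos m 1 a\<bar>" .
  have "2 * sqrt (real m - real (card ?T) - 1) = sqrt (2\<^sup>2 * (real m - real (card ?T) - 1))"
    by (simp only: real_sqrt_mult real_sqrt_abs abs_numeral)
  also have "\<dots> < l - 2"
  proof (rule real_less_lsqrt)
    show "0 \<le> l - 2" by (simp add: l_def)
    have "real (card ?T) = l" using sym_interval(2) [OF h] by (simp add: l_def)
    thus "2\<^sup>2 * (real m - real (card ?T) - 1) < (l - 2)\<^sup>2"
      using ml by (simp add: power2_eq_square algebra_simps)
  qed
  finally show ?thesis
    using ge cayley_ramanujan_complement_iff [OF m2 sym_interval(1) [OF h]] m1
    by (meson linorder_not_le order_trans zero_less_one)
qed

section \<open>Spread of multiples and the cosine sum\<close>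

text \<open>A Bohr set of frequency \<open>j\<close> and radius \<open>l / 3\<close>: the residues
  where the cosine may come close to 1.\<close>

definition near_zero :: "nat \<Rightarrow> nat \<Rightarrow> nat \<Rightarrow> int set" where
  "near_zero m j l = {a \<in> {0..<int m}. 3 * ((a * int j) mod int m) < int l \<or>
     3 * (int m - (a * int j) mod int m) < int l}"

text \<open>
  If at least a quarter of the elements of \<open>T\<close> are sent by multiplication by \<open>j\<close> to distance
  at least \<open>l/3\<close> from the multiples of \<open>m\<close>, the cosine sum loses \<open>3/l\<close>, more than the
  deficit \<open>l - sqrt (l\<^sup>2 - 5)\<close> of the Ramanujan bound.
\<close>

lemma cos_sum_le_of_spread:
  assumes m: "m = k\<^sup>2 + 5 * k + 5" and k: "k \<ge> 100" and l: "l = 2 * k + 3"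
    and T: "sym_subset m T" "card T = l"
    and near: "4 * card (near_zero m j l) \<le> 3 * l"
  shows "\<bar>\<Sum>a\<in>T. circ_cos m j a\<bar> \<le> 2 * sqrt (real m - real (card T) - 1)"
proof -
  have m0: "m > 0" using m by simp
  have T': "T \<subseteq> {0..<int m}" "0 \<in> T" using T by (auto simp: sym_subset_def)
  have finT: "finite T" using T'(1) by (rule finite_subset) simp
  define G where "G = T - near_zero m j l"
  define D where "D = real l / (3 * real m)"
  have l0: "real l \<ge> 203" using k l by simp
  have finN: "finite (near_zero m j l)" 
    by (rule finite_subset [of _ "{0..<int m}"]) (auto simp: near_zero_def)
  have "card T - card (near_zero m j l) \<le> card G"
    unfolding G_def by (rule diff_card_le_card_Diff [OF finN])
  hence "l \<le> 4 * card G" using near T(2) by linarith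
  hence cardG: "real l / 4 \<le> real (card G)" by linarith
  have loss: "8 * D\<^sup>2 \<le> 1 - circ_cos m j a" if a: "a \<in> G" for a
  proof -
    define r where "r = (a * int j) mod int m"
    have "a \<in> {0..<int m}" "a \<notin> near_zero m j l" using a T' by (auto simp: G_def)
    hence r: "int l \<le> 3 * r" "int l \<le> 3 * (int m - r)"
      unfolding near_zero_def r_def by auto
    have "D \<le> of_int r / real m" "of_int r / real m \<le> 1 - D"
    proof -
      have "real_of_int (int l) \<le> of_int (3 * r)" "real_of_int (int l) \<le> of_int (3 * (int m - r))"
        using r by (simp_all only: of_int_le_iff)
      thus "D \<le> of_int r / real m" "of_int r / real m \<le> 1 - D"
        using m0 by (simp_all add: D_def field_simps)
    qed
    moreover have "0 \<le> D" by (simp add: D_def)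
    moreover have "circ_cos m j a = cos (2 * pi * (of_int r / real m))"
      using m0 by (intro circ_cos_eq) (simp_all add: r_def cong_def)
    ultimately show ?thesis using one_minus_cos_ge by metis
  qed
  \<comment> \<open>A loss of \<open>8 * D^2\<close> on a quarter of \<open>T\<close> amounts to
    \<open>2 * l^3 / (9 * m^2)\<close>, which reaches \<open>3 / l\<close> once
    \<open>27 * m^2 <= 2 * l^4\<close>. Since \<open>m\<close> is about \<open>l^2 / 4\<close>, the
    factor 27/100 is available, and its square is below 2/27.\<close>
  have "100 * m \<le> 27 * l\<^sup>2"
  proof -
    have "100 * k \<le> k\<^sup>2" using k by (simp add: power2_eq_square)
    moreover have "l\<^sup>2 = 4 * k\<^sup>2 + 12 * k + 9" unfolding l by (simp add: power2_eq_square algebra_simps)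
    ultimately show ?thesis using m k by linarith
  qed
  hence "real (100 * m) \<le> real (27 * l\<^sup>2)" by (simp only: of_nat_le_iff)
  hence "real m \<le> 27 / 100 * (real l)\<^sup>2" by simp
  hence "(real m)\<^sup>2 \<le> (27 / 100 * (real l)\<^sup>2)\<^sup>2" by (intro power_mono) simp_all
  also have "\<dots> \<le> 2 / 27 * real l ^ 4" by (simp add: power_mult_distrib power_divide)
  finally have "27 * (real m)\<^sup>2 \<le> 2 * real l ^ 4" by simp
  hence "3 / real l \<le> real l / 4 * (8 * D\<^sup>2)"
    using m0 l0 by (simp add: D_def field_simps power_divide power2_eq_square power4_eq_xxxx)
  also have "\<dots> \<le> real (card G) * (8 * D\<^sup>2)" using cardG by (intro mult_right_mono) auto
  also have "\<dots> = (\<Sum>a\<in>G. 8 * D\<^sup>2)" by simp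
  also have "\<dots> \<le> (\<Sum>a\<in>G. 1 - circ_cos m j a)" by (intro sum_mono loss)
  also have "\<dots> \<le> (\<Sum>a\<in>T. 1 - circ_cos m j a)"
    using finT circ_cos_le_1 by (intro sum_mono2) (auto simp: G_def)
  also have "\<dots> = real l - (\<Sum>a\<in>T. circ_cos m j a)" using T(2) by (simp add: sum_subtractf)
  finally have upper: "(\<Sum>a\<in>T. circ_cos m j a) \<le> real l - 3 / real l" by simp
  \<comment> \<open>For the lower bound, 0 contributes 1 and every other element at least -1; the
    resulting gain of 2 over \<open>-l\<close> exceeds \<open>3 / l\<close>.\<close>
  have "(\<Sum>a\<in>T. circ_cos m j a) = 1 + (\<Sum>a\<in>T - {0}. circ_cos m j a)"
    using sum.remove [OF finT T'(2), of "circ_cos m j"] by simp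
  moreover have "(\<Sum>a\<in>T - {0}. - 1) \<le> (\<Sum>a\<in>T - {0}. circ_cos m j a)"
    using circ_cos_abs_le_1 by (intro sum_mono) (simp add: abs_le_iff minus_le_iff)
  moreover have "(\<Sum>a\<in>T - {0}. - 1) = 1 - real l"
    using T(2) T'(2) l by (simp add: card_Diff_singleton)
  ultimately have lower: "2 - real l \<le> (\<Sum>a\<in>T. circ_cos m j a)" by linarith
  have "3 / real l \<le> 2" using l0 by (simp add: field_simps)
  hence "\<bar>\<Sum>a\<in>T. circ_cos m j a\<bar> \<le> real l - 3 / real l" using upper lower by linarith
  also have "\<dots> \<le> sqrt (2\<^sup>2 * (real m - real (card T) - 1))"
  proof (rule real_le_rsqrt)
    \<comment> \<open>After squaring, the claim is
      \<open>l^2 - 6 + 9 / l^2 <= l^2 - 5\<close>.\<close>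
    have "2\<^sup>2 * (real m - real (card T) - 1) = (real l)\<^sup>2 - 5"
      unfolding m T(2) l by (simp add: power2_eq_square algebra_simps)
    moreover have "(real l - 3 / real l)\<^sup>2 = (real l)\<^sup>2 - 6 + (3 / real l)\<^sup>2"
      using l0 by (simp add: power2_diff)
    moreover have "(3 / real l)\<^sup>2 \<le> 1" using l0 by (intro power_le_one) (simp_all add: field_simps)
    ultimately show "(real l - 3 / real l)\<^sup>2 \<le> 2\<^sup>2 * (real m - real (card T) - 1)" by linarith
  qed
  also have "\<dots> = 2 * sqrt (real m - real (card T) - 1)"
    by (simp only: real_sqrt_mult real_sqrt_abs abs_numeral)
  finally show ?thesis .
qed

text \<open>Multiplication by \<open>j\<close> permutes the residues, so it is enough to count those
  closer than \<open>l / 3\<close> to 0, about two thirds of \<open>l\<close>.\<close>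

lemma card_near_zero_coprime:
  assumes "coprime j m" "m > 0" "l \<ge> 4"
  shows "4 * card (near_zero m j l) \<le> 3 * l"
proof -
  define s where "s = (l - 1) div 3"
  have s: "3 * x < int l \<longleftrightarrow> x \<le> int s" for x
    using assms(3) unfolding s_def by presburger
  have "inj_on (\<lambda>a. (a * int j) mod int m) {0..<int m}"
  proof (rule inj_onI)
    fix a b assume ab: "a \<in> {0..<int m}" "b \<in> {0..<int m}" "(a * int j) mod int m = (b * int j) mod int m"
    hence "[a * int j = b * int j] (mod int m)" by (simp add: cong_def)
    hence "[a = b] (mod int m)" using assms(1) by (subst (asm) cong_mult_rcancel) auto
    thus "a = b" using ab(1,2) by (simp add: cong_def)
  qed
  hence "inj_on (\<lambda>a. (a * int j) mod int m) (near_zero m j l)"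
    by (rule inj_on_subset) (auto simp: near_zero_def)
  moreover have "(\<lambda>a. (a * int j) mod int m) ` near_zero m j l
      \<subseteq> {0..int s} \<union> {int m - int s..<int m}"
  proof (rule image_subsetI)
    fix a assume "a \<in> near_zero m j l"
    hence "(a * int j) mod int m \<le> int s \<or> int m - (a * int j) mod int m \<le> int s"
      unfolding near_zero_def s by blast
    thus "(a * int j) mod int m \<in> {0..int s} \<union> {int m - int s..<int m}"
      using assms(2) by auto
  qed
  ultimately have "card (near_zero m j l) \<le> card ({0..int s} \<union> {int m - int s..<int m})"
    by (rule card_inj_on_le) simp
  also have "\<dots> \<le> card {0..int s} + card {int m - int s..<int m}" by (rule card_Un_le)
  also have "\<dots> = 2 * s + 1" by simp
  \<comment> \<open>The inequality \<open>8 * (l - 1) / 3 + 4 <= 3 * l\<close> amounts to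
    \<open>l >= 4\<close>.\<close>
  finally show ?thesis using assms(3) unfolding s_def by linarith
qed

text \<open>Every \<open>a * j\<close> is a multiple of \<open>d\<close> modulo \<open>m\<close>. As
  \<open>d >= l / 3\<close>, being close to 0 means being 0, which confines \<open>a\<close> to the
  subgroup of order \<open>d\<close>.\<close>

lemma card_near_zero_gcd:
  assumes d: "d = gcd j m" and m: "m > 0" and l: "l \<le> 3 * d" "4 * d \<le> 3 * l"
  shows "4 * card (near_zero m j l) \<le> 3 * l"
proof -
  have d0: "d > 0" using d m by simp
  have "near_zero m j l \<subseteq> (\<lambda>b. int (m div d) * b) ` {0..<int d}"
  proof
    fix a assume a: "a \<in> near_zero m j l"
    define r where "r = (a * int j) mod int m"
    have "int d dvd int m" "int d dvd int j" using d by (simp_all flip: of_nat_dvd_iff)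
    hence dr: "int d dvd r" "int d dvd int m - r" unfolding r_def by (simp_all add: dvd_mod)
    have "0 \<le> r" "r < int m" using m by (simp_all add: r_def)
    have "r = 0"
    proof (rule ccontr)
      assume "r \<noteq> 0"
      hence "int d \<le> r" "int d \<le> int m - r"
        using dr \<open>0 \<le> r\<close> \<open>r < int m\<close> by (auto intro: zdvd_imp_le)
      thus False using a l unfolding near_zero_def r_def by auto
    qed
    hence "int m dvd a * int j" unfolding r_def by (simp add: mod_eq_0_iff_dvd)
    moreover have mj: "int m = int d * int (m div d)" "int j = int d * int (j div d)"
      using d by (simp_all flip: of_nat_mult)
    ultimately have "int d * int (m div d) dvd int d * (a * int (j div d))"
      by (metis mult.left_commute)
    hence "int (m div d) dvd a * int (j div d)" using d0 by simp
    moreover have "coprime (int (m div d)) (int (j div d))"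
      using d m by (simp add: div_gcd_coprime coprime_commute)
    ultimately have "int (m div d) dvd a" using coprime_dvd_mult_left_iff by blast
    then obtain b where b: "a = int (m div d) * b" by blast
    have pos: "int (m div d) > 0" using mj(1) m by (metis mult_eq_0_iff of_nat_0_less_iff of_nat_eq_0_iff not_gr_zero)
    have "0 \<le> a" "a < int m" using a by (auto simp: near_zero_def)
    hence "0 \<le> b" "b < int d"
      using pos unfolding b mj(1) by (simp_all add: zero_le_mult_iff mult.commute)
    thus "a \<in> (\<lambda>b. int (m div d) * b) ` {0..<int d}" using b by auto
  qed
  hence "card (near_zero m j l) \<le> card {0..<int d}" by (rule surj_card_le [rotated]) simp
  thus ?thesis using l by simp
qed

text \<open>Up to covalency \<open>2 * k + 1\<close> the trivial bound suffices; at
  \<open>2 * k + 3\<close> the gcd condition keeps \<open>near_zero\<close> small for every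
  frequency; at \<open>2 * k + 5\<close> the interval fails.\<close>

lemma exceptional_criterion:
  assumes m: "m = k\<^sup>2 + 5 * k + 5" and k: "k \<ge> 100"
    and gcds: "\<And>j. 0 < j \<Longrightarrow> j < m \<Longrightarrow>
      coprime j m \<or> 2 * k + 3 \<le> 3 * gcd j m \<and> 4 * gcd j m \<le> 3 * (2 * k + 3)"
  shows "exceptional m"
proof -
  have kk: "100 * k \<le> k\<^sup>2" using k by (simp add: power2_eq_square)
  have "odd (k * (k + 5) + 5)" by simp
  hence odd: "odd m" unfolding m by (simp add: power2_eq_square algebra_simps)
  have h: "2 * (2 * (k + 2) + 1) < m" "2 * (2 * (k + 1) + 1) < m" "m \<ge> 2" "m > 0" "m \<ge> 15"
    using m kk k by simp_all
  have si: "2 * (k + 1) < m" "2 * (k + 2) < m" using h by simp_all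
  have "l_hat m = 2 * k + 3"
  proof (rule l_hat_eqI [OF odd])
    show "cayley_subset m ({0..<int m} - sym_interval m (k + 1))"
      "covalency m ({0..<int m} - sym_interval m (k + 1)) = 2 * k + 3"
      using cayley_subset_of_complement [OF sym_interval(1) [OF si(1)]]
        sym_interval(2) [OF si(1)] h(2) by simp_all
    show "cayley_subset m ({0..<int m} - sym_interval m (k + 2))"
      "covalency m ({0..<int m} - sym_interval m (k + 2)) = 2 * k + 3 + 2"
      using cayley_subset_of_complement [OF sym_interval(1) [OF si(2)]]
        sym_interval(2) [OF si(2)] h(1) by simp_all
    show "\<not> cayley_ramanujan m ({0..<int m} - sym_interval m (k + 2))"
      by (rule not_ramanujan_interval [OF m k])
    fix S assume S: "cayley_subset m S" "covalency m S \<le> 2 * k + 3"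
    note T = cayley_subset_complement [OF h(4) S(1)]
    have "odd (covalency m S)" using odd_card_sym_subset [OF odd T(1)] T(3) by simp
    hence "covalency m S = 2 * k + 3 \<or> covalency m S + 2 \<le> 2 * k + 3"
      using S(2) by presburger
    thus "cayley_ramanujan m S"
    proof
      assume "covalency m S + 2 \<le> 2 * k + 3"
      hence "(covalency m S + 2)\<^sup>2 \<le> (2 * k + 3)\<^sup>2" by (rule power_mono) simp
      also have "\<dots> \<le> 4 * m" unfolding m by (simp add: power2_eq_square algebra_simps)
      finally show ?thesis by (rule cayley_ramanujan_small_covalency [OF h(3) S(1)])
    next
      assume l: "covalency m S = 2 * k + 3"
      have "4 * card (near_zero m j (2 * k + 3)) \<le> 3 * (2 * k + 3)" if "0 < j" "j < m" for j
        using gcds [OF that]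
      proof
        assume "coprime j m"
        thus ?thesis using h(4) k by (intro card_near_zero_coprime) simp_all
      next
        assume "2 * k + 3 \<le> 3 * gcd j m \<and> 4 * gcd j m \<le> 3 * (2 * k + 3)"
        thus ?thesis using h(4) by (intro card_near_zero_gcd [OF refl]) simp_all
      qed
      thus ?thesis
        using cayley_ramanujan_complement_iff [OF h(3) T(1)] T(2,3) l
          cos_sum_le_of_spread [OF m k refl T(1)] by simp
    qed
  qed
  thus ?thesis using odd h l_zero_quadratic [OF m] by (simp add: exceptional_def)
qed

section \<open>Ordinary moduli\<close>

text \<open>
  A union of the subgroup \<open>p\<int>\<close> and of a few elements congruent to \<open>\<pm>1\<close> modulo \<open>p\<close>: the frequency
  \<open>q\<close> maps the subgroup to 0 and the other elements to \<open>\<pm>q\<close>.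
\<close>

lemma exists_coset_concentrated_set:
  fixes p q c :: nat
  assumes p: "p > 2" and c: "c \<le> q" and q: "q > 0"
  shows "\<exists>T. sym_subset (p * q) T \<and> card T = q + 2 * c \<and>
    real (q + 2 * c) - 64 * real c / (real p)\<^sup>2 \<le> (\<Sum>a\<in>T. circ_cos (p * q) q a)"
proof -
  define m where "m = p * q"
  have m0: "m > 0" using p q by (simp add: m_def)
  \<comment> \<open>\<open>A\<close> is the subgroup of order \<open>q\<close>, \<open>B\<close>
    holds \<open>c\<close> elements congruent to 1 modulo \<open>p\<close>, and \<open>C\<close>
    holds their negatives, as \<open>p * (q - i) - 1 = m - (p * i + 1)\<close>.\<close>
  define A where "A = (\<lambda>i. int p * int i) ` {..<q}"
  define B where "B = (\<lambda>i. int p * int i + 1) ` {..<c}"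
  define C where "C = (\<lambda>i. int p * (int q - int i) - 1) ` {..<c}"
  have bound: "int p * int i + int p \<le> int m" if "i < q" for i
  proof -
    have "int p * (int i + 1) \<le> int p * int q" using that by (intro mult_left_mono) auto
    thus ?thesis by (simp add: m_def algebra_simps)
  qed
  have fin: "finite A" "finite B" "finite C" by (simp_all add: A_def B_def C_def)
  have modA: "a mod int p = 0" if "a \<in> A" for a using that by (auto simp: A_def)
  have modB: "a mod int p = 1" if "a \<in> B" for a using that p by (auto simp: B_def)
  have modC: "a mod int p = int p - 1" if "a \<in> C" for a
  proof -
    obtain i where "a = int p * (int q - int i) - 1" using \<open>a \<in> C\<close> by (auto simp: C_def)
    hence "a = (int p - 1) + (int q - int i - 1) * int p" by (simp add: algebra_simps)
    hence "a mod int p = (int p - 1) mod int p" by simp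
    also have "\<dots> = int p - 1" using p by (intro mod_pos_pos_trivial) auto
    finally show ?thesis .
  qed
  \<comment> \<open>The classes 0, 1 and \<open>p - 1\<close> modulo \<open>p\<close> are distinct
    because \<open>p > 2\<close>.\<close>
  have disj: "A \<inter> B = {}" "(A \<union> B) \<inter> C = {}"
  proof -
    have "False" if "a \<in> A" "a \<in> B" for a using modA [OF that(1)] modB [OF that(2)] by simp
    moreover have "False" if "a \<in> A" "a \<in> C" for a
      using modA [OF that(1)] modC [OF that(2)] p by simp
    moreover have "False" if "a \<in> B" "a \<in> C" for a
      using modB [OF that(1)] modC [OF that(2)] p by simp
    ultimately show "A \<inter> B = {}" "(A \<union> B) \<inter> C = {}" by blast+
  qed
  have cards: "card A = q" "card B = c" "card C = c"
    using p unfolding A_def B_def C_def by (simp_all add: card_image inj_on_def)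
  define T where "T = A \<union> B \<union> C"
  have "card T = card (A \<union> B) + card C" unfolding T_def using fin disj by (intro card_Un_disjoint) auto
  also have "card (A \<union> B) = card A + card B" using fin disj by (intro card_Un_disjoint) auto
  finally have cardT: "card T = q + 2 * c" using cards by simp
  have sym: "sym_subset m T"
    unfolding sym_subset_def
  proof (intro conjI ballI)
    show "0 \<in> T" using q by (auto simp: T_def A_def intro!: image_eqI [of _ _ 0])
    have C_eq: "C = (\<lambda>i. int m - (int p * int i + 1)) ` {..<c}"
      by (simp add: C_def m_def algebra_simps)
    have "y \<in> {0..<int m}" "y + 1 \<in> {0..<int m}" "int m - (y + 1) \<in> {0..<int m}"
      if "i < q" "y = int p * int i" for i y
    proof -
      have "0 \<le> y" "y + int p \<le> int m" using bound that by simp_all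
      thus "y \<in> {0..<int m}" "y + 1 \<in> {0..<int m}" "int m - (y + 1) \<in> {0..<int m}"
        using p by auto
    qed
    thus "T \<subseteq> {0..<int m}"
      unfolding T_def A_def B_def C_eq using c by (intro Un_least image_subsetI) (meson lessThan_iff less_le_trans)+
    fix a assume "a \<in> T"
    then consider "a \<in> A" | "a \<in> B" | "a \<in> C" by (auto simp: T_def)
    thus "(- a) mod int m \<in> T"
    proof cases
      case 1
      then obtain i where i: "i < q" "a = int p * int i" by (auto simp: A_def)
      show ?thesis
      proof (cases "i = 0")
        case True
        thus ?thesis using i \<open>0 \<in> T\<close> by simp
      next
        case False
        hence "(- a) mod int m = int p * int (q - i)"
          using i bound [of i] p by (simp add: zmod_zminus1_eq_if m_def of_nat_diff algebra_simps)
        moreover have "q - i < q" using False i by simp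
        ultimately show ?thesis by (auto simp: T_def A_def)
      qed
    next
      case 2
      then obtain i where i: "i < c" "a = int p * int i + 1" by (auto simp: B_def)
      have "0 < a" "a < int m" using i bound [of i] p c by (simp_all add: add_nonneg_pos)
      hence "(- a) mod int m = int m - a" by (simp add: zmod_zminus1_eq_if)
      hence "(- a) mod int m = int p * (int q - int i) - 1"
        using i by (simp add: m_def algebra_simps)
      thus ?thesis using i by (auto simp: T_def C_def)
    next
      case 3
      then obtain i where i: "i < c" "a = int p * (int q - int i) - 1" by (auto simp: C_def)
      hence "- a = (int p * int i + 1) + (- 1) * int m" by (simp add: m_def algebra_simps)
      hence "(- a) mod int m = (int p * int i + 1) mod int m" by (simp only: mod_mult_self1)
      also have "\<dots> = int p * int i + 1" using bound [of i] i p c by (intro mod_pos_pos_trivial) auto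
      finally show ?thesis using i by (auto simp: T_def B_def)
    qed
  qed
  \<comment> \<open>Bounds the loss at each of the \<open>2 * c\<close> elements outside the
    subgroup, whose phase is \<open>1 / p\<close> or \<open>-1 / p\<close>; the total is at most
    \<open>64 * c / p^2\<close>.\<close>
  define \<epsilon> where "\<epsilon> = 32 * (1 / real p)\<^sup>2"
  have qm: "\<bar>of_int (int q) / real m\<bar> \<le> 1 / real p" "\<bar>of_int (- int q) / real m\<bar> \<le> 1 / real p"
    using p q by (simp_all add: m_def)
  have cosA: "circ_cos m q a = 1" if "a \<in> A" for a
  proof -
    have "circ_cos m q a = cos (2 * pi * (of_int 0 / real m))"
      by (rule circ_cos_eq [OF m0]) (use that in \<open>auto simp: A_def m_def cong_0_iff\<close>)
    thus ?thesis by simp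
  qed
  have cosB: "1 - \<epsilon> \<le> circ_cos m q a" if "a \<in> B" for a
  proof -
    obtain i where "a = int p * int i + 1" using \<open>a \<in> B\<close> by (auto simp: B_def)
    hence "a * int q - int q = int m * int i" by (simp add: m_def algebra_simps)
    hence "[a * int q = int q] (mod int m)" by (simp add: cong_iff_dvd_diff)
    thus ?thesis unfolding \<epsilon>_def using qm(1) by (intro circ_cos_ge [OF m0])
  qed
  have cosC: "1 - \<epsilon> \<le> circ_cos m q a" if "a \<in> C" for a
  proof -
    obtain i where a: "a = int p * (int q - int i) - 1" using \<open>a \<in> C\<close> by (auto simp: C_def)
    have "a * int q - (- int q) = int m * (int q - int i)"
      unfolding a by (simp add: m_def algebra_simps)
    hence "[a * int q = - int q] (mod int m)" by (simp only: cong_iff_dvd_diff dvd_triv_left)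
    thus ?thesis unfolding \<epsilon>_def using qm(2) by (intro circ_cos_ge [OF m0])
  qed
  have "(\<Sum>a\<in>B. 1 - \<epsilon>) \<le> (\<Sum>a\<in>B. circ_cos m q a)" by (intro sum_mono cosB)
  moreover have "(\<Sum>a\<in>C. 1 - \<epsilon>) \<le> (\<Sum>a\<in>C. circ_cos m q a)" by (intro sum_mono cosC)
  moreover have "(\<Sum>a\<in>A. circ_cos m q a) = real q" using cosA cards by simp
  moreover have "(\<Sum>a\<in>T. circ_cos m q a) =
      (\<Sum>a\<in>A. circ_cos m q a) + (\<Sum>a\<in>B. circ_cos m q a) + (\<Sum>a\<in>C. circ_cos m q a)"
    unfolding T_def using fin disj by (simp add: sum.union_disjoint)
  moreover have "real (q + 2 * c) - 64 * real c / (real p)\<^sup>2 = real q + real c * (1 - \<epsilon>) + real c * (1 - \<epsilon>)"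
    by (simp add: \<epsilon>_def algebra_simps power_divide)
  ultimately have "real (q + 2 * c) - 64 * real c / (real p)\<^sup>2 \<le> (\<Sum>a\<in>T. circ_cos m q a)"
    using cards by simp
  thus ?thesis using sym cardT unfolding m_def by blast
qed

text \<open>The trivial bound settles covalency \<open>2 * k + 1\<close>. At
  \<open>l = 2 * k + 3\<close> the concentrated set loses at most \<open>x = 64 * c / p^2\<close>;
  the hypothesis \<open>small\<close> says \<open>2 * l * x < 5\<close>, so
  \<open>(l - x)^2 > l^2 - 5\<close>.\<close>

lemma ordinary_criterion:
  assumes m: "m = k\<^sup>2 + 5 * k + 5" "m = p * q" and k: "k \<ge> 100" and p: "p > 2" "q > 0"
    and c: "2 * k + 3 = q + 2 * c" "c \<le> q" and small: "128 * (c * (2 * k + 3)) < 5 * p\<^sup>2"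
  shows "ordinary m"
proof -
  have kk: "100 * k \<le> k\<^sup>2" using k by (simp add: power2_eq_square)
  have "odd (k * (k + 5) + 5)" by simp
  hence odd: "odd m" unfolding m(1) by (simp add: power2_eq_square algebra_simps)
  have h: "2 * (2 * k + 3) < m" "2 * (2 * k + 1) < m" "m \<ge> 2" "m > 0" "m \<ge> 15"
    using m(1) kk k by simp_all
  have si: "2 * k < m" using h by simp
  obtain T where T: "sym_subset m T" "card T = 2 * k + 3"
    "real (2 * k + 3) - 64 * real c / (real p)\<^sup>2 \<le> (\<Sum>a\<in>T. circ_cos m q a)"
    using exists_coset_concentrated_set [OF p(1) c(2) p(2)] c(1) m(2) by auto
  have "l_hat m = 2 * k + 1"
  proof (rule l_hat_eqI [OF odd])
    show "cayley_subset m ({0..<int m} - sym_interval m k)"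
      "covalency m ({0..<int m} - sym_interval m k) = 2 * k + 1"
      using cayley_subset_of_complement [OF sym_interval(1) [OF si]]
        sym_interval(2) [OF si] h(2) by simp_all
    show "cayley_subset m ({0..<int m} - T)" "covalency m ({0..<int m} - T) = 2 * k + 1 + 2"
      using cayley_subset_of_complement [OF T(1)] T(2) h(1) by simp_all
    show "cayley_ramanujan m S" if S: "cayley_subset m S" "covalency m S \<le> 2 * k + 1" for S
    proof (rule cayley_ramanujan_small_covalency [OF h(3) S(1)])
      have "(covalency m S + 2)\<^sup>2 \<le> (2 * k + 3)\<^sup>2" using S(2) by (intro power_mono) simp_all
      also have "\<dots> \<le> 4 * m" unfolding m(1) by (simp add: power2_eq_square algebra_simps)
      finally show "(covalency m S + 2)\<^sup>2 \<le> 4 * m" .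
    qed
    show "\<not> cayley_ramanujan m ({0..<int m} - T)"
    proof
      assume "cayley_ramanujan m ({0..<int m} - T)"
      moreover have "q < m" using p m(2) by simp
      ultimately have "\<bar>\<Sum>a\<in>T. circ_cos m q a\<bar> \<le> 2 * sqrt (real m - real (card T) - 1)"
        using cayley_ramanujan_complement_iff [OF h(3) T(1)] p(2) by blast
      also have "\<dots> = sqrt (2\<^sup>2 * (real m - real (card T) - 1))"
        by (simp only: real_sqrt_mult real_sqrt_abs abs_numeral)
      also have "2\<^sup>2 * (real m - real (card T) - 1) = (real (2 * k + 3))\<^sup>2 - 5"
        unfolding m(1) T(2) by (simp add: power2_eq_square algebra_simps)
      finally have le: "\<bar>\<Sum>a\<in>T. circ_cos m q a\<bar> \<le> sqrt ((real (2 * k + 3))\<^sup>2 - 5)" .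
      define l where "l = real (2 * k + 3)"
      define x where "x = 64 * real c / (real p)\<^sup>2"
      have "real (128 * (c * (2 * k + 3))) < real (5 * p\<^sup>2)" using small by (simp only: of_nat_less_iff)
      hence "2 * (l * x) < 5"
        using p(1) by (simp add: l_def x_def field_simps)
      hence "sqrt (l\<^sup>2 - 5) < sqrt ((l - x)\<^sup>2)"
        unfolding power2_diff using zero_le_power2 [of x] by (intro real_sqrt_less_mono) linarith
      also have "\<dots> = \<bar>l - x\<bar>" by simp
      finally have lt: "sqrt (l\<^sup>2 - 5) < \<bar>l - x\<bar>" .
      \<comment> \<open>Yields \<open>x < l\<close>, which removes the absolute value.\<close>
      have "3 * 3 \<le> l * l" by (intro mult_mono) (simp_all add: l_def)
      hence "l * x < l * l" using \<open>2 * (l * x) < 5\<close> by linarith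
      hence "x < l" by (simp add: l_def)
      hence "sqrt (l\<^sup>2 - 5) < l - x" using lt by simp
      thus False using le T(3) unfolding l_def x_def by linarith
    qed
  qed
  thus ?thesis using odd h l_zero_quadratic [OF m(1)] by (simp add: ordinary_def)
qed

section \<open>Infinitely many moduli\<close>

text \<open>Carries infinitely many parameters over to infinitely many moduli:
  \<open>n <= g n\<close> makes \<open>B\<close> unbounded.\<close>

lemma infinite_nat_image_unbounded:
  fixes g :: "nat \<Rightarrow> nat"
  assumes A: "infinite A" and g: "\<And>n. n \<in> A \<Longrightarrow> N \<le> n \<Longrightarrow> g n \<in> B \<and> n \<le> g n"
  shows "infinite B"
  unfolding infinite_nat_iff_unbounded
proof
  fix M
  obtain n where n: "n \<in> A" "n > max M N" using A unfolding infinite_nat_iff_unbounded by blast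
  hence "g n \<in> B \<and> n \<le> g n" by (intro g) simp_all
  thus "\<exists>b>M. b \<in> B" using n by (intro exI [of _ "g n"]) auto
qed

lemma dvd_prime_mult_prime:
  fixes p q g :: nat
  assumes pq: "prime p" "prime q" and g: "g dvd p * q"
  shows "g = 1 \<or> g = p \<or> g = q \<or> g = p * q"
proof (cases "p dvd g")
  case True
  then obtain t where t: "g = p * t" by blast
  hence "t dvd q" using g pq by (simp add: prime_gt_0_nat)
  thus ?thesis using t pq(2) by (auto simp: prime_nat_iff)
next
  case False
  hence "coprime g p" using pq(1) by (metis coprime_commute prime_imp_coprime)
  hence "g dvd q" using g by (simp add: coprime_dvd_mult_right_iff)
  thus ?thesis using pq(2) by (auto simp: prime_nat_iff)
qed

lemma J_set_quadratic: "m = k\<^sup>2 + 5 * k + 5 \<Longrightarrow> k \<ge> 4 \<Longrightarrow> m \<in> J_set"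
  unfolding J_set_def by (intro UnI1 UnI2 CollectI exI [of _ k] conjI bexI [of _ 5]) simp_all

section \<open>The three families of moduli\<close>

lemma exceptional_prime:
  assumes "prime (k\<^sup>2 + 5 * k + 5)" "k \<ge> 100"
  shows "exceptional (k\<^sup>2 + 5 * k + 5)"
proof (rule exceptional_criterion [OF refl assms(2)])
  fix j assume "0 < j" "j < k\<^sup>2 + 5 * k + 5"
  hence "\<not> (k\<^sup>2 + 5 * k + 5) dvd j" by (auto dest: dvd_imp_le)
  thus "coprime j (k\<^sup>2 + 5 * k + 5) \<or> 2 * k + 3 \<le> 3 * gcd j (k\<^sup>2 + 5 * k + 5) \<and>
      4 * gcd j (k\<^sup>2 + 5 * k + 5) \<le> 3 * (2 * k + 3)"
    using prime_imp_coprime [OF assms(1)] coprime_commute by blast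
qed

lemma exceptional_product:
  fixes n p q :: nat
  assumes p: "p = n\<^sup>2 + 5 * n + 5" "prime p" and q: "q = n\<^sup>2 + 7 * n + 11" "prime q" and n: "n \<ge> 100"
  shows "exceptional (p * q)" "p * q \<in> J_set"
proof -
  \<comment> \<open>With \<open>f(x) = x^2 + 5x + 5\<close> this is \<open>n + f(n)\<close>, while
    \<open>p = f(n)\<close> and \<open>q = f(n + 1)\<close>.\<close>
  define k where "k = n\<^sup>2 + 6 * n + 5"
  have m: "p * q = k\<^sup>2 + 5 * k + 5"
    unfolding p(1) q(1) k_def by (simp add: power2_eq_square algebra_simps)
  have k: "k \<ge> 100" using n by (simp add: k_def)
  show "p * q \<in> J_set" using J_set_quadratic [OF m] k by linarith
  show "exceptional (p * q)"
  proof (rule exceptional_criterion [OF m k])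
    fix j assume j: "0 < j" "j < p * q"
    have "gcd j (p * q) \<noteq> p * q" using j by (metis gcd_le1_nat linorder_not_le not_gr_zero)
    hence "gcd j (p * q) = 1 \<or> gcd j (p * q) = p \<or> gcd j (p * q) = q"
      using dvd_prime_mult_prime [OF p(2) q(2), of "gcd j (p * q)"] by auto
    moreover have "2 * k + 3 \<le> 3 * p" "4 * p \<le> 3 * (2 * k + 3)" "2 * k + 3 \<le> 3 * q" "4 * q \<le> 3 * (2 * k + 3)"
      using p(1) q(1) n by (simp_all add: k_def power2_eq_square)
    ultimately show "coprime j (p * q) \<or> 2 * k + 3 \<le> 3 * gcd j (p * q) \<and> 4 * gcd j (p * q) \<le> 3 * (2 * k + 3)"
      by (auto simp: coprime_iff_gcd_eq_1)
  qed
qed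

text \<open>Here \<open>2 * k + 3\<close> exceeds \<open>q\<close> by only
  \<open>2 * (n - 1)\<close>, so \<open>c = n - 1\<close>; then \<open>c * (2 * k + 3)\<close> is of
  order \<open>n^3\<close>, against \<open>n^4\<close> for \<open>p^2\<close>.\<close>

lemma ordinary_product:
  fixes n p q :: nat
  assumes p: "p + 1 = n\<^sup>2 + n" and q: "q + 5 = 4 * n\<^sup>2" and n: "n \<ge> 200"
  shows "ordinary (p * q)" "p * q \<in> J_set"
proof -
  have nn: "200 * n \<le> n\<^sup>2" using n by (simp add: power2_eq_square)
  define k where "k = 2 * n\<^sup>2 + n - 5"
  have k: "k + 5 = 2 * n\<^sup>2 + n" using n unfolding k_def by simp
  \<comment> \<open>Over the integers subtraction is exact and the product formula becomes a
    polynomial identity.\<close>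
  have ip: "int p = (int n)\<^sup>2 + int n - 1" and iq: "int q = 4 * (int n)\<^sup>2 - 5"
    and ik: "int k = 2 * (int n)\<^sup>2 + int n - 5"
    using arg_cong [OF p, of int] arg_cong [OF q, of int] arg_cong [OF k, of int] by simp_all
  have "int (p * q) = int (k\<^sup>2 + 5 * k + 5)"
    by (simp add: ip iq ik power2_eq_square algebra_simps)
  hence m: "p * q = k\<^sup>2 + 5 * k + 5" by (simp only: of_nat_eq_iff)
  have k100: "k \<ge> 100" using k n nn by simp
  show "p * q \<in> J_set" using J_set_quadratic [OF m] k100 by linarith
  show "ordinary (p * q)"
  proof (rule ordinary_criterion [OF m refl k100])
    show "p > 2" "q > 0" "n - 1 \<le> q" "2 * k + 3 = q + 2 * (n - 1)"
      using p q k n nn by simp_all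
    \<comment> \<open>The left side is at most \<open>640 * n^3\<close> and \<open>5 * p^2\<close>
      is at least \<open>5 * n^4\<close>, so \<open>n > 128\<close> is enough.\<close>
    have "128 * ((n - 1) * (2 * k + 3)) \<le> 128 * (n * (5 * n\<^sup>2))"
      using k n nn by (intro mult_le_mono) simp_all
    also have "\<dots> < 5 * (n\<^sup>2)\<^sup>2" using n by (simp add: power2_eq_square)
    also have "\<dots> \<le> 5 * p\<^sup>2" using p n by (intro mult_le_mono power_mono) simp_all
    finally show "128 * ((n - 1) * (2 * k + 3)) < 5 * p\<^sup>2" .
  qed
qed

theorem theorem5p3:
  assumes "bateman_horn_conjecture"
  shows "(infinite {m::nat. prime m \<and> odd m \<and> exceptional m} \<and>
          infinite {m::nat. m \<in> J_set \<and> exceptional m \<and>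
            (\<exists>p q. prime p \<and> odd p \<and> prime q \<and> odd q \<and> p < q \<and> q < 4 * p \<and> m = p * q)}) \<and>
         infinite {m::nat. m \<in> J_set \<and> ordinary m \<and>
            (\<exists>p q. prime p \<and> odd p \<and> prime q \<and> odd q \<and> p < q \<and> q < 4 * p \<and> m = p * q)}"
proof (intro conjI)
  show "infinite {m::nat. prime m \<and> odd m \<and> exceptional m}"
  proof (rule infinite_nat_image_unbounded [OF infinite_prime_values [OF assms]])
    fix n :: nat assume "n \<in> {n. n > 0 \<and> prime (n\<^sup>2 + 5 * n + 5)}" "100 \<le> n"
    thus "n\<^sup>2 + 5 * n + 5 \<in> {m. prime m \<and> odd m \<and> exceptional m} \<and> n \<le> n\<^sup>2 + 5 * n + 5"
      using exceptional_prime [of n] by (auto simp: exceptional_def)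
  qed
  show "infinite {m::nat. m \<in> J_set \<and> exceptional m \<and>
    (\<exists>p q. prime p \<and> odd p \<and> prime q \<and> odd q \<and> p < q \<and> q < 4 * p \<and> m = p * q)}" (is "infinite ?B")
  proof (rule infinite_nat_image_unbounded [OF infinite_consecutive_prime_values [OF assms]])
    fix n :: nat
    define p where "p = n\<^sup>2 + 5 * n + 5"
    define q where "q = n\<^sup>2 + 7 * n + 11"
    assume "n \<in> {n. n > 0 \<and> prime (n\<^sup>2 + 5 * n + 5) \<and> prime (n\<^sup>2 + 7 * n + 11)}" and n: "100 \<le> n"
    hence pq: "prime p" "prime q" by (simp_all add: p_def q_def)
    have "exceptional (p * q)" "p * q \<in> J_set"
      using exceptional_product [OF p_def pq(1) q_def pq(2) n] .
    \<comment> \<open>An exceptional modulus is odd by definition, hence so are its factors.\<close>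
    moreover have "odd p" "odd q" using calculation(1) by (simp_all add: exceptional_def)
    moreover have "p < q" "q < 4 * p" using n by (simp_all add: p_def q_def)
    ultimately have "p * q \<in> ?B" using pq by blast
    moreover have "n \<le> p" by (simp add: p_def)
    hence "n \<le> p * q" using mult_le_mono [of n p 1 q] prime_ge_1_nat [OF pq(2)] by simp
    ultimately show "(n\<^sup>2 + 5 * n + 5) * (n\<^sup>2 + 7 * n + 11) \<in> ?B \<and>
        n \<le> (n\<^sup>2 + 5 * n + 5) * (n\<^sup>2 + 7 * n + 11)" unfolding p_def q_def by blast
  qed
  show "infinite {m::nat. m \<in> J_set \<and> ordinary m \<and>
    (\<exists>p q. prime p \<and> odd p \<and> prime q \<and> odd q \<and> p < q \<and> q < 4 * p \<and> m = p * q)}" (is "infinite ?B")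
  proof (rule infinite_nat_image_unbounded [OF infinite_unbalanced_prime_values [OF assms]])
    fix n :: nat
    define p where "p = n\<^sup>2 + n - 1"
    define q where "q = 4 * n\<^sup>2 - 5"
    assume "n \<in> {n. n > 1 \<and> prime (n\<^sup>2 + n - 1) \<and> prime (4 * n\<^sup>2 - 5)}" and n: "200 \<le> n"
    hence pq: "prime p" "prime q" by (simp_all add: p_def q_def)
    have nn: "200 * n \<le> n\<^sup>2" using n by (simp add: power2_eq_square)
    have p: "p + 1 = n\<^sup>2 + n" and q: "q + 5 = 4 * n\<^sup>2"
      using n nn by (simp_all add: p_def q_def)
    have "ordinary (p * q)" "p * q \<in> J_set"
      using ordinary_product [OF p q n] .
    moreover have "odd p" "odd q" using calculation(1) by (simp_all add: ordinary_def)
    \<comment> \<open>The gap \<open>4 * p - q\<close> is only \<open>4 * n + 1\<close>.\<close>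
    moreover have "p < q" "q < 4 * p" using n nn p q by simp_all
    ultimately have "p * q \<in> ?B" using pq by blast
    moreover have "n \<le> p" using p n nn by simp
    hence "n \<le> p * q" using mult_le_mono [of n p 1 q] prime_ge_1_nat [OF pq(2)] by simp
    ultimately show "(n\<^sup>2 + n - 1) * (4 * n\<^sup>2 - 5) \<in> ?B \<and> n \<le> (n\<^sup>2 + n - 1) * (4 * n\<^sup>2 - 5)"
      unfolding p_def q_def by blast
  qed
qed

end
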